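(* For every integer $d \geq 2$ there exists a finite simplicial complex which is topologically $d$-representable but not $d$-collapsible.
   Context: Simplicial complexes are finite abstract simplicial complexes; the empty set counts as a face of dimension $-1$. Good covers: a $d$-cell is an open subset of $\mathbb{R}^d$ homeomorphic to an open $d$-ball. A good cover in $\mathbb{R}^d$ is a collection $\mathcal{G}$ of $d$-cells in $\mathbb{R}^d$ such that for every subcollection $\mathcal{G}' \subseteq \mathcal{G}$ the intersection of the sets in $\mathcal{G}'$ is either empty or a $d$-cell. Nerve: the nerve of a collection $\mathcal{F}$ of sets in $\mathbb{R}^d$ is the simplicial complex whose vertices are the sets in $\mathcal{F}$ and whose faces are the collections of vertices with nonempty intersection. Topologically $d$-representable: a finite simplicial complex is topologically $d$-representable if it is isomorphic to the nerve of a (finite) good cover in $\mathbb{R}^d$. $d$-collapsible: let $\mathbf{K}$ be a simplicial complex and let $\sigma$ be a face of $\mathbf{K}$ of dimension at most $d-1$ such that there is only one maximal (with respect to inclusion) face of $\mathbf{K}$ containing $\sigma$. Then the complex $\mathbf{K}' := \mathbf{K} \setminus \{\eta \in \mathbf{K} : \sigma \subseteq \eta\}$ is said to arise from $\mathbf{K}$ by an elementary $d$-collapse. The complex $\mathbf{K}$ is $d$-collapsible if it can be reduced to the empty complex by a (finite) sequence of elementary $d$-collapses. *)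

theory Defs
  imports "HOL-Analysis.Analysis"
begin

(* Prefixed names avoid the geometric simplicial_complex of HOL-Analysis. The vertex set of K is
   \<Union>K. Both {{}} (only the empty face) and {} (no face at all) are admitted; the latter is
   the empty complex at which collapsing ends. *)

definition abstract_complex :: "'a set set \<Rightarrow> bool" where
  "abstract_complex K \<longleftrightarrow>
     finite K \<and> (\<forall>\<sigma>\<in>K. finite \<sigma>) \<and> (\<forall>\<sigma>\<in>K. \<forall>\<tau>. \<tau> \<subseteq> \<sigma> \<longrightarrow> \<tau> \<in> K)"

definition face_dim :: "'a set \<Rightarrow> int" where
  "face_dim \<sigma> = int (card \<sigma>) - 1"

definition maximal_face :: "'a set set \<Rightarrow> 'a set \<Rightarrow> bool" where
  "maximal_face K \<tau> \<longleftrightarrow> \<tau> \<in> K \<and> (\<forall>\<rho>\<in>K. \<tau> \<subseteq> \<rho> \<longrightarrow> \<rho> = \<tau>)"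

definition complex_isomorphic :: "'a set set \<Rightarrow> 'b set set \<Rightarrow> bool" where
  "complex_isomorphic K L \<longleftrightarrow>
     (\<exists>f. bij_betw f (\<Union>K) (\<Union>L) \<and> (\<forall>\<sigma>. \<sigma> \<subseteq> \<Union>K \<longrightarrow> (\<sigma> \<in> K \<longleftrightarrow> f ` \<sigma> \<in> L)))"

definition elementary_collapse :: "nat \<Rightarrow> 'a set set \<Rightarrow> 'a set set \<Rightarrow> bool" where
  "elementary_collapse d K K' \<longleftrightarrow>
     (\<exists>\<sigma>\<in>K. face_dim \<sigma> \<le> int d - 1 \<and>
            (\<exists>!\<tau>. maximal_face K \<tau> \<and> \<sigma> \<subseteq> \<tau>) \<and>
            K' = K - {\<eta> \<in> K. \<sigma> \<subseteq> \<eta>})"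

definition collapsible :: "nat \<Rightarrow> 'a set set \<Rightarrow> bool" where
  "collapsible d K \<longleftrightarrow> (elementary_collapse d)\<^sup>*\<^sup>* K {}"

definition unit_open_ball :: "nat \<Rightarrow> (nat \<Rightarrow> real) set" where
  "unit_open_ball d = {x \<in> topspace (Euclidean_space d). (\<Sum>i<d. (x i)\<^sup>2) < 1}"

definition cell :: "nat \<Rightarrow> (nat \<Rightarrow> real) set \<Rightarrow> bool" where
  "cell d U \<longleftrightarrow>
     openin (Euclidean_space d) U \<and>
     subtopology (Euclidean_space d) U homeomorphic_space
       subtopology (Euclidean_space d) (unit_open_ball d)"

(* Intersections are taken inside R^d, so that the empty subcollection yields R^d rather than
   the whole type nat \<Rightarrow> real. *)

definition good_cover :: "nat \<Rightarrow> (nat \<Rightarrow> real) set set \<Rightarrow> bool" where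
  "good_cover d \<G> \<longleftrightarrow>
     (\<forall>U\<in>\<G>. cell d U) \<and>
     (\<forall>\<G>'. \<G>' \<subseteq> \<G> \<longrightarrow>
        topspace (Euclidean_space d) \<inter> \<Inter>\<G>' = {} \<or> cell d (topspace (Euclidean_space d) \<inter> \<Inter>\<G>'))"

definition nerve :: "'a set set \<Rightarrow> 'a set set set" where
  "nerve \<F> = {\<sigma>. \<sigma> \<subseteq> \<F> \<and> \<Inter>\<sigma> \<noteq> {}}"

definition topologically_representable :: "nat \<Rightarrow> 'a set set \<Rightarrow> bool" where
  "topologically_representable d K \<longleftrightarrow>
     (\<exists>\<G>. finite \<G> \<and> good_cover d \<G> \<and> complex_isomorphic K (nerve \<G>))"

end

theory Submission
  imports Defs "HOL-Complex_Analysis.Riemann_Mapping"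
begin

text \<open>
  An elementary d-collapse needs a face with at most d vertices that lies in a unique maximal face.
  There is none if the link of every face with at most d vertices has two vertices that are not joined
  by an edge, so it suffices to find a good cover whose nerve has this property.

  In the plane, the faces of a trivalent tiling of the sphere would do: any two neighbours share an
  edge, whose two ends lie on disjoint third tiles. For a tiling of a disc the property fails only
  along the boundary, and the missing outer face cannot be added because it is not a cell. Instead
  the boundary is covered by three arc-shaped cells that overlap cyclically and turn into the
  interior at their ends, where they are far enough apart for all intersections to be cells.

  Suspension raises the dimension: thickening a good cover of d-space by a new coordinate and adding
  two disjoint slabs across that coordinate joins the nerve with two points. A face of a join with at
  most m + n + 1 vertices has at most m of them on one side or at most n on the other, so the join of
  a complex that has the property for m with one that has it for n has it for m + n + 1; the two points
  have it for 0.
\<close>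

section \<open>Complexes with incomplete links\<close>

definition incomplete_links :: "nat \<Rightarrow> 'a set set \<Rightarrow> bool" where
  "incomplete_links n K \<longleftrightarrow>
     (\<forall>\<sigma>\<in>K. card \<sigma> \<le> n \<longrightarrow> (\<exists>x y. insert x \<sigma> \<in> K \<and> insert y \<sigma> \<in> K \<and> insert x (insert y \<sigma>) \<notin> K))"

lemma abstract_complex_subset:
  assumes "abstract_complex K" "\<sigma> \<in> K" "\<tau> \<subseteq> \<sigma>"
  shows "\<tau> \<in> K"
  using assms unfolding abstract_complex_def by blast

lemma abstract_complex_finite_face:
  assumes "abstract_complex K" "\<sigma> \<in> K"
  shows "finite \<sigma>"
  using assms unfolding abstract_complex_def by blast

lemma face_subset_maximal_face:
  assumes "abstract_complex K" "\<sigma> \<in> K"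
  obtains \<tau> where "maximal_face K \<tau>" "\<sigma> \<subseteq> \<tau>"
  using finite_has_maximal2[of K \<sigma>] assms
  unfolding abstract_complex_def maximal_face_def by metis

lemma not_collapsible_if_incomplete_links:
  assumes K: "abstract_complex K" "K \<noteq> {}" and links: "incomplete_links d K"
  shows "\<not> collapsible d K"
proof
  assume "collapsible d K"
  then obtain K' where "elementary_collapse d K K'"
    using \<open>K \<noteq> {}\<close> unfolding collapsible_def by (metis converse_rtranclpE)
  then obtain \<sigma> where \<sigma>: "\<sigma> \<in> K" "face_dim \<sigma> \<le> int d - 1"
    and unique: "\<exists>!\<tau>. maximal_face K \<tau> \<and> \<sigma> \<subseteq> \<tau>"
    unfolding elementary_collapse_def by blast
  have "card \<sigma> \<le> d"
    using \<sigma>(2) by (simp add: face_dim_def)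
  obtain x y where xy: "insert x \<sigma> \<in> K" "insert y \<sigma> \<in> K" "insert x (insert y \<sigma>) \<notin> K"
    using links \<sigma>(1) \<open>card \<sigma> \<le> d\<close> unfolding incomplete_links_def by blast
  obtain \<tau> where \<tau>: "maximal_face K \<tau>" "insert x \<sigma> \<subseteq> \<tau>"
    using face_subset_maximal_face[OF K(1) xy(1)] .
  obtain \<tau>' where \<tau>': "maximal_face K \<tau>'" "insert y \<sigma> \<subseteq> \<tau>'"
    using face_subset_maximal_face[OF K(1) xy(2)] .
  have "\<tau>' = \<tau>"
    using unique \<tau> \<tau>' by blast
  then have "insert x (insert y \<sigma>) \<subseteq> \<tau>" "\<tau> \<in> K"
    using \<tau> \<tau>' by (auto simp: maximal_face_def)
  then show False
    using xy(3) abstract_complex_subset[OF K(1)] by blast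
qed

lemma face_subset_edge:
  assumes K: "abstract_complex K" and w: "w \<in> \<Union>K" and \<sigma>: "\<sigma> \<in> K" "card \<sigma> \<le> 2"
  obtains u v where "\<sigma> \<subseteq> {u, v}" "{u, v} \<in> K"
proof -
  have "card \<sigma> = 0 \<or> card \<sigma> = 1 \<or> card \<sigma> = 2"
    using \<sigma>(2) by linarith
  then consider (empty) "\<sigma> = {}" | (vertex) u where "\<sigma> = {u}" | (edge) u v where "\<sigma> = {u, v}"
    using abstract_complex_finite_face[OF K \<sigma>(1)] by (auto simp: card_1_singleton_iff card_2_iff)
  then show thesis
  proof cases
    case empty
    have "{w, w} \<in> K"
      using w abstract_complex_subset[OF K] by auto
    with empty show thesis using that by blast
  next
    case vertex
    with \<sigma>(1) show thesis using that[of u u] by simp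
  next
    case edge
    with \<sigma>(1) show thesis using that by blast
  qed
qed

lemma incomplete_links_2I:
  assumes K: "abstract_complex K" and w: "w \<in> \<Union>K"
    and extend: "\<And>u v. {u, v} \<in> K \<Longrightarrow> \<exists>x y. {x, u, v} \<in> K \<and> {y, u, v} \<in> K \<and> {x, y} \<notin> K"
  shows "incomplete_links 2 K"
  unfolding incomplete_links_def
proof (intro ballI impI)
  note downward = abstract_complex_subset[OF K]
  fix \<sigma> assume \<sigma>: "\<sigma> \<in> K" "card \<sigma> \<le> 2"
  obtain u v where uv: "\<sigma> \<subseteq> {u, v}" "{u, v} \<in> K"
    using face_subset_edge[OF K w \<sigma>] .
  obtain x y where xy: "{x, u, v} \<in> K" "{y, u, v} \<in> K" "{x, y} \<notin> K"
    using extend[OF uv(2)] by blast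
  have "insert x \<sigma> \<in> K" "insert y \<sigma> \<in> K"
    by (rule downward[OF xy(1)] downward[OF xy(2)], use uv(1) in blast)+
  moreover have "insert x (insert y \<sigma>) \<notin> K"
    using downward[of "insert x (insert y \<sigma>)" "{x, y}"] xy(3) by blast
  ultimately show "\<exists>x y. insert x \<sigma> \<in> K \<and> insert y \<sigma> \<in> K \<and> insert x (insert y \<sigma>) \<notin> K"
    by blast
qed

lemma complex_isomorphic_trans:
  assumes "complex_isomorphic K L" "complex_isomorphic L M"
  shows "complex_isomorphic K M"
proof -
  obtain f where f: "bij_betw f (\<Union>K) (\<Union>L)" "\<And>\<sigma>. \<sigma> \<subseteq> \<Union>K \<Longrightarrow> \<sigma> \<in> K \<longleftrightarrow> f ` \<sigma> \<in> L"
    using assms(1) unfolding complex_isomorphic_def by blast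
  obtain g where g: "bij_betw g (\<Union>L) (\<Union>M)" "\<And>\<sigma>. \<sigma> \<subseteq> \<Union>L \<Longrightarrow> \<sigma> \<in> L \<longleftrightarrow> g ` \<sigma> \<in> M"
    using assms(2) unfolding complex_isomorphic_def by blast
  have "\<sigma> \<in> K \<longleftrightarrow> (g \<circ> f) ` \<sigma> \<in> M" if "\<sigma> \<subseteq> \<Union>K" for \<sigma>
  proof -
    have "f ` \<sigma> \<subseteq> \<Union>L"
      using image_mono[OF that, of f] bij_betw_imp_surj_on[OF f(1)] by simp
    then show ?thesis
      using f(2)[OF that] g(2) by (simp add: image_comp)
  qed
  then show ?thesis
    using bij_betw_trans[OF f(1) g(1)] unfolding complex_isomorphic_def by blast
qed

lemma complex_isomorphic_sym:
  assumes "complex_isomorphic K L"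
  shows "complex_isomorphic L K"
proof -
  obtain f where f: "bij_betw f (\<Union>K) (\<Union>L)" "\<And>\<sigma>. \<sigma> \<subseteq> \<Union>K \<Longrightarrow> \<sigma> \<in> K \<longleftrightarrow> f ` \<sigma> \<in> L"
    using assms unfolding complex_isomorphic_def by blast
  let ?g = "inv_into (\<Union>K) f"
  have "\<sigma> \<in> L \<longleftrightarrow> ?g ` \<sigma> \<in> K" if "\<sigma> \<subseteq> \<Union>L" for \<sigma>
  proof -
    have "?g ` \<sigma> \<subseteq> \<Union>K"
      using image_mono[OF that, of ?g] bij_betw_imp_surj_on[OF bij_betw_inv_into[OF f(1)]] by simp
    moreover have "f ` ?g ` \<sigma> = \<sigma>"
      using that bij_betw_imp_surj_on[OF f(1)] by (simp add: image_inv_into_cancel)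
    ultimately show ?thesis
      using f(2) by metis
  qed
  then show ?thesis
    using bij_betw_inv_into[OF f(1)] unfolding complex_isomorphic_def by blast
qed

lemma incomplete_links_isomorphic:
  assumes "complex_isomorphic K L" "incomplete_links n K"
  shows "incomplete_links n L"
  unfolding incomplete_links_def
proof (intro ballI impI)
  obtain f where f: "bij_betw f (\<Union>K) (\<Union>L)" "\<And>\<sigma>. \<sigma> \<subseteq> \<Union>K \<Longrightarrow> \<sigma> \<in> K \<longleftrightarrow> f ` \<sigma> \<in> L"
    using assms(1) unfolding complex_isomorphic_def by blast
  fix \<tau> assume \<tau>: "\<tau> \<in> L" "card \<tau> \<le> n"
  then have "\<tau> \<subseteq> f ` \<Union>K"
    using bij_betw_imp_surj_on[OF f(1)] by (simp add: Union_upper)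
  then obtain \<sigma> where \<sigma>: "\<sigma> \<subseteq> \<Union>K" "\<tau> = f ` \<sigma>"
    by (rule subset_imageE)
  have "\<sigma> \<in> K"
    using \<tau>(1) f(2)[OF \<sigma>(1)] by (simp add: \<sigma>(2))
  moreover have "card \<sigma> \<le> n"
    using \<tau>(2) card_image[OF inj_on_subset[OF bij_betw_imp_inj_on[OF f(1)] \<sigma>(1)]] by (simp add: \<sigma>(2))
  ultimately obtain x y where xy: "insert x \<sigma> \<in> K" "insert y \<sigma> \<in> K" "insert x (insert y \<sigma>) \<notin> K"
    using assms(2) unfolding incomplete_links_def by blast
  then have "insert x (insert y \<sigma>) \<subseteq> \<Union>K"
    using Union_upper[OF xy(1)] Union_upper[OF xy(2)] by simp
  then have "f ` insert x \<sigma> \<in> L" "f ` insert y \<sigma> \<in> L" "f ` insert x (insert y \<sigma>) \<notin> L"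
    using xy f(2)[of "insert x \<sigma>"] f(2)[of "insert y \<sigma>"] f(2)[of "insert x (insert y \<sigma>)"] by simp_all
  then show "\<exists>x y. insert x \<tau> \<in> L \<and> insert y \<tau> \<in> L \<and> insert x (insert y \<tau>) \<notin> L"
    unfolding \<sigma>(2) image_insert by blast
qed

lemma abstract_complex_image:
  assumes "abstract_complex K"
  shows "abstract_complex ((`) f ` K)"
  using assms unfolding abstract_complex_def by (auto elim!: subset_imageE)

lemma complex_isomorphic_image:
  assumes f: "inj_on f (\<Union>K)"
  shows "complex_isomorphic K ((`) f ` K)"
  unfolding complex_isomorphic_def
proof (intro exI conjI allI impI)
  show "bij_betw f (\<Union>K) (\<Union>((`) f ` K))"
    using f by (simp add: bij_betw_def image_Union)
  fix \<sigma> assume \<sigma>: "\<sigma> \<subseteq> \<Union>K"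
  have "\<sigma> = \<tau>" if "\<tau> \<in> K" "f ` \<sigma> = f ` \<tau>" for \<tau>
    using inj_on_image_eq_iff[OF f \<sigma>] that by blast
  then show "\<sigma> \<in> K \<longleftrightarrow> f ` \<sigma> \<in> (`) f ` K"
    by blast
qed

lemma isomorphic_nat_complex:
  assumes "abstract_complex K"
  obtains K' :: "nat set set" where "abstract_complex K'" "complex_isomorphic K K'"
proof -
  have "finite (\<Union>K)"
    using assms by (auto simp: abstract_complex_def)
  from finite_imp_inj_to_nat_seg[OF this] obtain f :: "'a \<Rightarrow> nat" where "inj_on f (\<Union>K)"
    by metis
  then show thesis
    by (rule that[OF abstract_complex_image[OF assms] complex_isomorphic_image])
qed

section \<open>Joins\<close>

definition complex_join :: "'a set set \<Rightarrow> 'b set set \<Rightarrow> ('a + 'b) set set" where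
  "complex_join K L = {\<rho>. Inl -` \<rho> \<in> K \<and> Inr -` \<rho> \<in> L}"

lemma Plus_vimage_Inl_Inr: "Inl -` \<rho> <+> Inr -` \<rho> = \<rho>"
proof
  show "\<rho> \<subseteq> Inl -` \<rho> <+> Inr -` \<rho>"
  proof
    show "z \<in> Inl -` \<rho> <+> Inr -` \<rho>" if "z \<in> \<rho>" for z
      using that by (cases z) auto
  qed
qed auto

lemma vimage_Plus [simp]: "Inl -` (A <+> B) = A" "Inr -` (A <+> B) = B"
  by auto

lemma vimage_Inl_insert [simp]:
  "Inl -` insert (Inl x) \<rho> = insert x (Inl -` \<rho>)" "Inl -` insert (Inr y) \<rho> = Inl -` \<rho>"
  by auto

lemma vimage_Inr_insert [simp]:
  "Inr -` insert (Inr y) \<rho> = insert y (Inr -` \<rho>)" "Inr -` insert (Inl x) \<rho> = Inr -` \<rho>"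
  by auto

lemma image_map_sum_Plus: "map_sum f g ` (A <+> B) = f ` A <+> g ` B"
  by (simp add: Plus_def image_Un image_image)

lemma Union_complex_join:
  assumes "{} \<in> K" "{} \<in> L"
  shows "\<Union>(complex_join K L) = \<Union>K <+> \<Union>L"
proof (intro equalityI subsetI)
  fix z assume "z \<in> \<Union>(complex_join K L)"
  then show "z \<in> \<Union>K <+> \<Union>L"
    by (cases z) (auto simp: complex_join_def)
next
  fix z assume "z \<in> \<Union>K <+> \<Union>L"
  then consider (left) x \<sigma> where "z = Inl x" "x \<in> \<sigma>" "\<sigma> \<in> K"
    | (right) y \<tau> where "z = Inr y" "y \<in> \<tau>" "\<tau> \<in> L"
    by blast
  then show "z \<in> \<Union>(complex_join K L)"
  proof cases
    case left
    then have "\<sigma> <+> {} \<in> complex_join K L"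
      using assms by (simp add: complex_join_def)
    then show ?thesis using left by blast
  next
    case right
    then have "{} <+> \<tau> \<in> complex_join K L"
      using assms by (simp add: complex_join_def)
    then show ?thesis using right by blast
  qed
qed

lemma abstract_complex_join:
  assumes "abstract_complex K" "abstract_complex L"
  shows "abstract_complex (complex_join K L)"
  unfolding abstract_complex_def
proof (intro conjI ballI allI impI)
  have "complex_join K L \<subseteq> (\<lambda>(\<sigma>, \<tau>). \<sigma> <+> \<tau>) ` (K \<times> L)"
  proof
    fix \<rho> assume "\<rho> \<in> complex_join K L"
    then have "(Inl -` \<rho>, Inr -` \<rho>) \<in> K \<times> L"
      by (simp add: complex_join_def)
    then show "\<rho> \<in> (\<lambda>(\<sigma>, \<tau>). \<sigma> <+> \<tau>) ` (K \<times> L)"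
      by (rule rev_image_eqI) (simp add: Plus_vimage_Inl_Inr)
  qed
  then show "finite (complex_join K L)"
    using assms by (meson abstract_complex_def finite_SigmaI finite_imageI finite_subset)
  fix \<rho> assume "\<rho> \<in> complex_join K L"
  then have \<rho>: "Inl -` \<rho> \<in> K" "Inr -` \<rho> \<in> L"
    by (auto simp: complex_join_def)
  then have "finite (Inl -` \<rho> <+> Inr -` \<rho>)"
    using assms by (intro finite_Plus) (auto intro: abstract_complex_finite_face)
  then show "finite \<rho>"
    by (simp add: Plus_vimage_Inl_Inr)
  show "\<rho>' \<in> complex_join K L" if "\<rho>' \<subseteq> \<rho>" for \<rho>'
    unfolding complex_join_def
    using abstract_complex_subset[OF assms(1) \<rho>(1) vimage_mono[OF that]]
      abstract_complex_subset[OF assms(2) \<rho>(2) vimage_mono[OF that]] by simp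
qed

lemma incomplete_links_join:
  assumes K: "abstract_complex K" "incomplete_links m K"
    and L: "abstract_complex L" "incomplete_links n L"
  shows "incomplete_links (Suc (m + n)) (complex_join K L)"
  unfolding incomplete_links_def
proof (intro ballI impI)
  fix \<rho> assume "\<rho> \<in> complex_join K L" and card: "card \<rho> \<le> Suc (m + n)"
  then have \<rho>: "Inl -` \<rho> \<in> K" "Inr -` \<rho> \<in> L"
    by (auto simp: complex_join_def)
  have "card \<rho> = card (Inl -` \<rho>) + card (Inr -` \<rho>)"
    using K(1) L(1) \<rho> card_Plus[of "Inl -` \<rho>" "Inr -` \<rho>"]
    by (simp add: Plus_vimage_Inl_Inr abstract_complex_finite_face)
  then consider (left) "card (Inl -` \<rho>) \<le> m" | (right) "card (Inr -` \<rho>) \<le> n"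
    using card by linarith
  then show "\<exists>x y. insert x \<rho> \<in> complex_join K L \<and> insert y \<rho> \<in> complex_join K L \<and>
      insert x (insert y \<rho>) \<notin> complex_join K L"
  proof cases
    case left
    then obtain x y where "insert x (Inl -` \<rho>) \<in> K" "insert y (Inl -` \<rho>) \<in> K"
        "insert x (insert y (Inl -` \<rho>)) \<notin> K"
      using K(2) \<rho>(1) unfolding incomplete_links_def by blast
    then show ?thesis
      using \<rho>(2) by (intro exI[of _ "Inl x"] exI[of _ "Inl y"]) (simp add: complex_join_def)
  next
    case right
    then obtain x y where "insert x (Inr -` \<rho>) \<in> L" "insert y (Inr -` \<rho>) \<in> L"
        "insert x (insert y (Inr -` \<rho>)) \<notin> L"
      using L(2) \<rho>(2) unfolding incomplete_links_def by blast
    then show ?thesis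
      using \<rho>(1) by (intro exI[of _ "Inr x"] exI[of _ "Inr y"]) (simp add: complex_join_def)
  qed
qed

lemma complex_join_isomorphic_left:
  assumes "complex_isomorphic K K'" and empty: "{} \<in> K" "{} \<in> K'" "{} \<in> L"
  shows "complex_isomorphic (complex_join K L) (complex_join K' L)"
proof -
  obtain f where f: "bij_betw f (\<Union>K) (\<Union>K')" "\<And>\<sigma>. \<sigma> \<subseteq> \<Union>K \<Longrightarrow> \<sigma> \<in> K \<longleftrightarrow> f ` \<sigma> \<in> K'"
    using assms(1) unfolding complex_isomorphic_def by blast
  have "bij_betw (map_sum f id) (\<Union>K <+> \<Union>L) (\<Union>K' <+> \<Union>L)"
    unfolding bij_betw_def
  proof
    show "inj_on (map_sum f id) (\<Union>K <+> \<Union>L)"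
      using bij_betw_imp_inj_on[OF f(1)] by (auto simp: inj_on_def)
    show "map_sum f id ` (\<Union>K <+> \<Union>L) = \<Union>K' <+> \<Union>L"
      by (simp add: image_map_sum_Plus bij_betw_imp_surj_on[OF f(1)])
  qed
  moreover have "\<rho> \<in> complex_join K L \<longleftrightarrow> map_sum f id ` \<rho> \<in> complex_join K' L"
    if "\<rho> \<subseteq> \<Union>K <+> \<Union>L" for \<rho>
  proof -
    have "map_sum f id ` \<rho> = f ` Inl -` \<rho> <+> Inr -` \<rho>"
      using image_map_sum_Plus[of f id "Inl -` \<rho>" "Inr -` \<rho>"] by (simp add: Plus_vimage_Inl_Inr)
    moreover have "Inl -` \<rho> \<subseteq> \<Union>K"
      using that by auto
    ultimately show ?thesis
      using f(2) by (simp add: complex_join_def)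
  qed
  ultimately show ?thesis
    unfolding complex_isomorphic_def Union_complex_join[OF empty(1,3)] Union_complex_join[OF empty(2,3)]
    by blast
qed

definition two_points :: "bool set set" where
  "two_points = {\<tau>. \<tau> \<noteq> UNIV}"

lemma empty_in_two_points: "{} \<in> two_points"
  by (auto simp: two_points_def)

lemma singleton_in_two_points: "{b} \<in> two_points"
  by (cases b) (auto simp: two_points_def UNIV_bool)

lemma Union_two_points: "\<Union>two_points = UNIV"
  using singleton_in_two_points by blast

lemma abstract_complex_two_points: "abstract_complex two_points"
  unfolding abstract_complex_def two_points_def by auto

lemma incomplete_links_two_points: "incomplete_links 0 two_points"
proof -
  have "{True} \<in> two_points" "{False} \<in> two_points" "{True, False} \<notin> two_points"
    by (auto simp: two_points_def)
  then show ?thesis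
    unfolding incomplete_links_def by (auto simp: card_eq_0_iff)
qed

section \<open>Nerves and topological representability\<close>

lemma abstract_complex_nerve:
  assumes "finite \<G>"
  shows "abstract_complex (nerve \<G>)"
  unfolding abstract_complex_def
proof (intro conjI ballI allI impI)
  have "nerve \<G> \<subseteq> Pow \<G>"
    by (auto simp: nerve_def)
  then show "finite (nerve \<G>)"
    using assms by (simp add: finite_subset)
  show "finite \<sigma>" if "\<sigma> \<in> nerve \<G>" for \<sigma>
    using that assms by (auto simp: nerve_def intro: finite_subset)
  show "\<tau> \<in> nerve \<G>" if "\<sigma> \<in> nerve \<G>" "\<tau> \<subseteq> \<sigma>" for \<sigma> \<tau>
    using that Inter_anti_mono[OF that(2)] by (auto simp: nerve_def)
qed

lemma Union_nerve: "\<Union>(nerve \<G>) = \<G> - {{}}"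
proof (intro equalityI subsetI)
  fix U assume "U \<in> \<G> - {{}}"
  then have "{U} \<in> nerve \<G>"
    by (simp add: nerve_def)
  then show "U \<in> \<Union>(nerve \<G>)"
    by blast
qed (auto simp: nerve_def)

lemma complex_isomorphic_nerve_image:
  assumes K: "abstract_complex K" and f: "inj_on f (\<Union>K)"
    and face: "\<And>\<sigma>. \<sigma> \<subseteq> \<Union>K \<Longrightarrow> \<sigma> \<in> K \<longleftrightarrow> \<Inter>(f ` \<sigma>) \<noteq> {}"
  shows "complex_isomorphic K (nerve (f ` \<Union>K))"
  unfolding complex_isomorphic_def
proof (intro exI conjI allI impI)
  have "f v \<noteq> {}" if v: "v \<in> \<Union>K" for v
  proof -
    have "{v} \<in> K"
      using v abstract_complex_subset[OF K] by auto
    then show ?thesis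
      using face[of "{v}"] v by simp
  qed
  then have "{} \<notin> f ` \<Union>K"
    by (metis imageE)
  then have "\<Union>(nerve (f ` \<Union>K)) = f ` \<Union>K"
    by (simp add: Union_nerve)
  then show "bij_betw f (\<Union>K) (\<Union>(nerve (f ` \<Union>K)))"
    using f by (simp add: bij_betw_def)
  show "\<sigma> \<in> K \<longleftrightarrow> f ` \<sigma> \<in> nerve (f ` \<Union>K)" if "\<sigma> \<subseteq> \<Union>K" for \<sigma>
    using face[OF that] that by (auto simp: nerve_def)
qed

lemma complex_isomorphic_nerve_inj_image:
  assumes f: "inj f" and \<G>: "finite \<G>" "{} \<notin> \<G>"
  shows "complex_isomorphic (nerve \<G>) (nerve ((`) f ` \<G>))"
proof -
  have vertices: "\<Union>(nerve \<G>) = \<G>"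
    using \<G>(2) by (simp add: Union_nerve)
  have "inj_on ((`) f) \<G>"
    using f by (simp add: inj_on_def inj_image_eq_iff)
  moreover have "\<sigma> \<in> nerve \<G> \<longleftrightarrow> \<Inter>((`) f ` \<sigma>) \<noteq> {}" if \<sigma>: "\<sigma> \<subseteq> \<G>" for \<sigma>
  proof (cases "\<sigma> = {}")
    case False
    then have "f ` \<Inter>\<sigma> = \<Inter>((`) f ` \<sigma>)"
      using image_INT[of f UNIV \<sigma> "\<lambda>U. U"] f by auto
    then show ?thesis
      using \<sigma> by (auto simp: nerve_def)
  qed (simp add: nerve_def)
  ultimately show ?thesis
    using complex_isomorphic_nerve_image[OF abstract_complex_nerve[OF \<G>(1)], of "(`) f"]
    by (simp add: vertices)
qed

lemma topologically_representable_isomorphic: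
  assumes "topologically_representable d K" "complex_isomorphic K L"
  shows "topologically_representable d L"
  using assms(1) complex_isomorphic_trans[OF complex_isomorphic_sym[OF assms(2)]]
  unfolding topologically_representable_def by blast

lemma empty_in_topologically_representable:
  assumes "topologically_representable d K"
  shows "{} \<in> K"
proof -
  obtain \<G> :: "(nat \<Rightarrow> real) set set" where "complex_isomorphic K (nerve \<G>)"
    using assms unfolding topologically_representable_def by blast
  then obtain f where "\<forall>\<sigma>. \<sigma> \<subseteq> \<Union>K \<longrightarrow> (\<sigma> \<in> K \<longleftrightarrow> f ` \<sigma> \<in> nerve \<G>)"
    unfolding complex_isomorphic_def by blast
  from this[rule_format, of "{}"] show ?thesis
    by (simp add: nerve_def)
qed

section \<open>Cells\<close>

lemma top_of_set_topspace_Euclidean_space [simp]: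
  "top_of_set (topspace (Euclidean_space d)) = Euclidean_space d"
  by (simp add: Euclidean_space_def euclidean_product_topology)

lemma homeomorphic_space_top_of_set_iff:
  "top_of_set S homeomorphic_space top_of_set T \<longleftrightarrow> S homeomorphic T"
proof -
  have "homeomorphic_maps (top_of_set S) (top_of_set T) f g \<longleftrightarrow> homeomorphism S T f g" for f g
    by (force simp: Pi_iff homeomorphic_maps_def homeomorphism_def)
  then show ?thesis
    by (simp add: homeomorphic_space_def homeomorphic_def)
qed

lemma continuous_on_coordinate [continuous_intros]:
  "continuous_on S (\<lambda>x. (x i :: 'b::topological_space))"
  by (rule continuous_on_subset[OF continuous_on_product_coordinates]) simp

lemma continuous_on_fun_upd [continuous_intros]:
  assumes "continuous_on S f" "continuous_on S g"
  shows "continuous_on S (\<lambda>x. (f x)(i := g x))"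
proof (rule continuous_on_coordinatewise_then_product)
  show "continuous_on S (\<lambda>x. ((f x)(i := g x)) j)" for j
    using assms by (cases "j = i") (simp_all add: continuous_on_product_then_coordinatewise)
qed

lemma homeomorphic_Euclidean_space_unit_open_ball:
  "topspace (Euclidean_space d) homeomorphic unit_open_ball d"
proof -
  define s where "s x = (\<Sum>i<d. (x i)\<^sup>2)" for x :: "nat \<Rightarrow> real"
  define h where "h c x = (\<lambda>i. x i / sqrt (1 + c * s x))" for c x
  have ball: "x \<in> unit_open_ball d \<longleftrightarrow> x \<in> topspace (Euclidean_space d) \<and> s x < 1" for x
    by (simp add: unit_open_ball_def s_def)
  have pos: "0 < 1 + 1 * s x" for x
    using sum_nonneg[of "{..<d}" "\<lambda>i. (x i)\<^sup>2"] by (simp add: s_def)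
  have s_h: "s (h c x) = s x / (1 + c * s x)" if "0 < 1 + c * s x" for c x
    using that by (simp add: s_def h_def power_divide flip: sum_divide_distrib)
  have inverse: "h (- c) (h c x) = x" if "0 < 1 + c * s x" for c x
  proof -
    have "1 + - c * s (h c x) = 1 / (1 + c * s x)"
      using that by (simp add: s_h field_simps)
    then show ?thesis
      using that by (auto simp: h_def real_sqrt_divide)
  qed
  have continuous: "continuous_on S (h c)" if "\<And>x. x \<in> S \<Longrightarrow> 1 + c * s x \<noteq> 0" for S c
    using that unfolding h_def s_def
    by (intro continuous_on_coordinatewise_then_product continuous_intros) auto
  have topspace: "h c x \<in> topspace (Euclidean_space d)" if "x \<in> topspace (Euclidean_space d)" for c x
    using that by (simp add: topspace_Euclidean_space h_def)
  show ?thesis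
    unfolding homeomorphic_minimal
  proof (intro exI conjI ballI)
    show "h 1 x \<in> unit_open_ball d" "h (- 1) (h 1 x) = x" if "x \<in> topspace (Euclidean_space d)" for x
      using that pos[of x] inverse[OF pos] by (simp_all add: ball topspace s_h)
    show "h (- 1) x \<in> topspace (Euclidean_space d)" "h 1 (h (- 1) x) = x" if "x \<in> unit_open_ball d" for x
      using that inverse[of "- 1" x] by (simp_all add: ball topspace)
    show "continuous_on (topspace (Euclidean_space d)) (h 1)"
      by (rule continuous) (metis pos less_irrefl)
    show "continuous_on (unit_open_ball d) (h (- 1))"
      by (rule continuous) (auto simp: ball)
  qed
qed

lemma cell_iff:
  "cell d U \<longleftrightarrow> openin (Euclidean_space d) U \<and> U homeomorphic topspace (Euclidean_space d)"
proof (cases "openin (Euclidean_space d) U")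
  case True
  have sub: "subtopology (Euclidean_space d) W = top_of_set W" if "W \<subseteq> topspace (Euclidean_space d)" for W
    using that by (metis top_of_set_topspace_Euclidean_space inf.absorb_iff2 subtopology_subtopology)
  have "U \<subseteq> topspace (Euclidean_space d)" "unit_open_ball d \<subseteq> topspace (Euclidean_space d)"
    using True by (auto simp: openin_subset unit_open_ball_def)
  then have "cell d U \<longleftrightarrow> U homeomorphic unit_open_ball d"
    using True by (simp add: cell_def sub homeomorphic_space_top_of_set_iff)
  also have "\<dots> \<longleftrightarrow> U homeomorphic topspace (Euclidean_space d)"
    using homeomorphic_Euclidean_space_unit_open_ball homeomorphic_sym homeomorphic_trans by metis
  finally show ?thesis
    using True by simp
qed (simp add: cell_def)

lemma cell_topspace: "cell d (topspace (Euclidean_space d))"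
  by (simp add: cell_iff homeomorphic_refl)

lemma cell_subset: "cell d U \<Longrightarrow> U \<subseteq> topspace (Euclidean_space d)"
  by (simp add: cell_def openin_subset)

lemma cell_nonempty:
  assumes "cell d U"
  shows "U \<noteq> {}"
proof
  assume "U = {}"
  then have "topspace (Euclidean_space d) = {}"
    using assms by (simp add: cell_iff)
  then show False
    by (simp add: nontrivial_Euclidean_space)
qed

lemma good_cover_cell:
  assumes "good_cover d \<G>" "U \<in> \<G>"
  shows "cell d U"
  using assms by (simp add: good_cover_def)

lemma Inter_cells_eq_empty_iff:
  assumes "\<And>U. U \<in> \<G> \<Longrightarrow> cell d U"
  shows "topspace (Euclidean_space d) \<inter> \<Inter>\<G> = {} \<longleftrightarrow> \<Inter>\<G> = {}"
proof (cases "\<G> = {}")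
  case True
  then show ?thesis
    by (simp add: nontrivial_Euclidean_space)
next
  case False
  then have "\<Inter>\<G> \<subseteq> topspace (Euclidean_space d)"
    using assms cell_subset by blast
  then show ?thesis
    by (simp add: Int_absorb1)
qed

section \<open>Suspension\<close>

definition cylinder :: "nat \<Rightarrow> (nat \<Rightarrow> real) set \<Rightarrow> real set \<Rightarrow> (nat \<Rightarrow> real) set" where
  "cylinder d U I = {x. x(d := 0) \<in> U \<and> x d \<in> I}"

lemma homeomorphism_cylinder:
  assumes "U \<subseteq> topspace (Euclidean_space d)"
  shows "homeomorphism (cylinder d U I) (U \<times> I) (\<lambda>x. (x(d := 0), x d)) (\<lambda>(x, t). x(d := t))"
proof (rule homeomorphismI)
  have zero: "x(d := 0) = x" if "x \<in> U" for x
    using that assms by (simp add: topspace_Euclidean_space subset_iff fun_upd_idem)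
  show "(\<lambda>(x, t). x(d := t)) ` (U \<times> I) \<subseteq> cylinder d U I"
    by (auto simp: cylinder_def zero)
  show "(\<lambda>(x, t). x(d := t)) (x(d := 0), x d) = x" for x :: "nat \<Rightarrow> real"
    by simp
  show "(\<lambda>x. (x(d := 0), x d)) ((\<lambda>(x, t). x(d := t)) p) = p" if "p \<in> U \<times> I" for p
    using that by (auto simp: zero)
  show "continuous_on (cylinder d U I) (\<lambda>x. (x(d := 0), x d))"
    by (intro continuous_intros)
  show "continuous_on (U \<times> I) (\<lambda>(x, t). x(d := t))"
    unfolding case_prod_unfold by (intro continuous_intros)
qed (auto simp: cylinder_def)

lemma cylinder_topspace:
  "cylinder d (topspace (Euclidean_space d)) UNIV = topspace (Euclidean_space (Suc d))"
  by (auto simp: cylinder_def topspace_Euclidean_space Suc_le_eq)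

lemma cylinder_eq_empty_iff:
  assumes "U \<subseteq> topspace (Euclidean_space d)"
  shows "cylinder d U I = {} \<longleftrightarrow> U = {} \<or> I = {}"
  using homeomorphism_image1[OF homeomorphism_cylinder[OF assms, of I]] by auto

lemma homeomorphic_Times:
  assumes "S homeomorphic S'" "T homeomorphic T'"
  shows "S \<times> T homeomorphic S' \<times> T'"
  using homeomorphic_space_prod_topology[of "top_of_set S" "top_of_set S'" "top_of_set T" "top_of_set T'"] assms
  by (simp add: homeomorphic_space_top_of_set_iff)

lemma cell_cylinder:
  assumes U: "cell d U" and I: "open I" "I homeomorphic (UNIV :: real set)"
  shows "cell (Suc d) (cylinder d U I)"
  unfolding cell_iff
proof
  let ?E = "topspace (Euclidean_space d)"
  note hom = homeomorphism_cylinder[OF cell_subset[OF U], of I]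
  note homE = homeomorphism_cylinder[OF subset_refl, of d UNIV, unfolded cylinder_topspace]
  have "cylinder d U I homeomorphic U \<times> I"
    using hom homeomorphic_def by blast
  also have "U \<times> I homeomorphic ?E \<times> (UNIV :: real set)"
    using U I(2) by (simp add: cell_iff homeomorphic_Times)
  also have "\<dots> homeomorphic topspace (Euclidean_space (Suc d))"
    using homE homeomorphic_def homeomorphic_sym by blast
  finally show "cylinder d U I homeomorphic topspace (Euclidean_space (Suc d))" .
  have "openin (top_of_set (?E \<times> UNIV)) (U \<times> I)"
    using U I(1) by (intro openin_Times) (simp_all add: cell_def)
  moreover have "continuous_on (topspace (Euclidean_space (Suc d))) (\<lambda>x. (x(d := 0), x d))"
    "(\<lambda>x. (x(d := 0), x d)) \<in> topspace (Euclidean_space (Suc d)) \<rightarrow> ?E \<times> UNIV"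
    using homE by (auto simp: homeomorphism_def)
  ultimately have "openin (top_of_set (topspace (Euclidean_space (Suc d))))
      (topspace (Euclidean_space (Suc d)) \<inter> (\<lambda>x. (x(d := 0), x d)) -` (U \<times> I))"
    by (rule continuous_openin_preimage[rotated -1])
  moreover have "topspace (Euclidean_space (Suc d)) \<inter> (\<lambda>x. (x(d := 0), x d)) -` (U \<times> I) = cylinder d U I"
    using cell_subset[OF U] by (auto simp: cylinder_def simp flip: cylinder_topspace)
  ultimately show "openin (Euclidean_space (Suc d)) (cylinder d U I)"
    by simp
qed

text \<open>Bounded intervals serve as well as half-lines, and the library knows that they are homeomorphic
  to the line.\<close>

definition side :: "bool \<Rightarrow> real set" where
  "side b = (if b then {0<..<1} else {-1<..<0})"

primrec suspension_cell :: "nat \<Rightarrow> (nat \<Rightarrow> real) set + bool \<Rightarrow> (nat \<Rightarrow> real) set" where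
  "suspension_cell d (Inl U) = cylinder d U UNIV"
| "suspension_cell d (Inr b) = cylinder d (topspace (Euclidean_space d)) (side b)"

lemma homeomorphic_side: "side b homeomorphic (UNIV :: real set)"
  by (simp add: side_def homeomorphic_open_interval_UNIV)

lemma open_side: "open (side b)"
  by (simp add: side_def)

lemma Inter_side:
  obtains "\<tau> = UNIV" "\<Inter>(side ` \<tau>) = {}"
  | "\<tau> \<noteq> UNIV" "open (\<Inter>(side ` \<tau>))" "\<Inter>(side ` \<tau>) homeomorphic (UNIV :: real set)"
proof -
  consider (both) "\<tau> = UNIV" | (none) "\<tau> = {}" | (one) b where "\<tau> = {b}"
    using UNIV_bool by (metis (full_types) UNIV_eq_I insertI1 subset_singletonD subsetI)
  then show thesis
  proof cases
    case both
    then have "\<Inter>(side ` \<tau>) = {}"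
      by (auto simp: UNIV_bool side_def)
    with both show thesis using that(1) by blast
  next
    case none
    then show thesis using that(2) by (simp add: homeomorphic_refl)
  next
    case one
    moreover have "{b} \<noteq> UNIV"
      by (metis (full_types) UNIV_I singletonD)
    ultimately show thesis using that(2) by (simp add: homeomorphic_side open_side)
  qed
qed

lemma Inter_suspension_cells:
  "topspace (Euclidean_space (Suc d)) \<inter> \<Inter>(suspension_cell d ` \<rho>) =
   cylinder d (topspace (Euclidean_space d) \<inter> \<Inter>(Inl -` \<rho>)) (\<Inter>(side ` (Inr -` \<rho>)))"
proof (intro equalityI subsetI)
  fix x assume x: "x \<in> topspace (Euclidean_space (Suc d)) \<inter> \<Inter>(suspension_cell d ` \<rho>)"
  have "x \<in> suspension_cell d v" if "v \<in> \<rho>" for v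
    using x that by blast
  from this[of "Inl _"] this[of "Inr _"]
  show "x \<in> cylinder d (topspace (Euclidean_space d) \<inter> \<Inter>(Inl -` \<rho>)) (\<Inter>(side ` (Inr -` \<rho>)))"
    using x by (auto simp: cylinder_def topspace_Euclidean_space)
next
  fix x assume x: "x \<in> cylinder d (topspace (Euclidean_space d) \<inter> \<Inter>(Inl -` \<rho>)) (\<Inter>(side ` (Inr -` \<rho>)))"
  have "x \<in> suspension_cell d v" if "v \<in> \<rho>" for v
    using x that by (cases v) (auto simp: cylinder_def)
  moreover have "x \<in> topspace (Euclidean_space (Suc d))"
    using x cylinder_topspace[of d] by (auto simp: cylinder_def)
  ultimately show "x \<in> topspace (Euclidean_space (Suc d)) \<inter> \<Inter>(suspension_cell d ` \<rho>)"
    by blast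
qed

lemma cell_suspension_cell:
  assumes "\<And>U. v = Inl U \<Longrightarrow> cell d U"
  shows "cell (Suc d) (suspension_cell d v)"
  using assms
  by (cases v) (simp_all add: cell_cylinder cell_topspace open_side homeomorphic_side homeomorphic_refl)

lemma good_cover_suspension:
  assumes "good_cover d \<G>"
  shows "good_cover (Suc d) (suspension_cell d ` (\<G> <+> UNIV))"
  unfolding good_cover_def
proof (intro conjI ballI allI impI)
  show "cell (Suc d) W" if "W \<in> suspension_cell d ` (\<G> <+> UNIV)" for W
    using that good_cover_cell[OF assms] by (auto intro!: cell_suspension_cell simp del: suspension_cell.simps)
  fix \<H> assume "\<H> \<subseteq> suspension_cell d ` (\<G> <+> UNIV)"
  then obtain \<rho> where \<rho>: "\<rho> \<subseteq> \<G> <+> UNIV" "\<H> = suspension_cell d ` \<rho>"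
    by (rule subset_imageE)
  let ?U = "topspace (Euclidean_space d) \<inter> \<Inter>(Inl -` \<rho>)" and ?I = "\<Inter>(side ` (Inr -` \<rho>))"
  have "Inl -` \<rho> \<subseteq> \<G>"
    using \<rho>(1) by auto
  then have "?U = {} \<or> cell d ?U"
    using assms by (simp add: good_cover_def)
  moreover have "?I = {} \<or> open ?I \<and> ?I homeomorphic (UNIV :: real set)"
    by (rule Inter_side[of "Inr -` \<rho>"]) simp_all
  ultimately consider "?U = {} \<or> ?I = {}" | "cell d ?U" "open ?I" "?I homeomorphic (UNIV :: real set)"
    by blast
  then have "cylinder d ?U ?I = {} \<or> cell (Suc d) (cylinder d ?U ?I)"
    by cases (simp_all add: cylinder_eq_empty_iff cell_cylinder)
  then show "topspace (Euclidean_space (Suc d)) \<inter> \<Inter>\<H> = {} \<or>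
      cell (Suc d) (topspace (Euclidean_space (Suc d)) \<inter> \<Inter>\<H>)"
    unfolding \<rho>(2) Inter_suspension_cells .
qed

lemma inj_on_suspension_cell:
  assumes "good_cover d \<G>"
  shows "inj_on (suspension_cell d) (\<G> <+> UNIV)"
proof (rule inj_on_inverseI)
  let ?E = "topspace (Euclidean_space d)" and ?p = "(\<lambda>_. 0)(d := 1/2)"
  fix v :: "(nat \<Rightarrow> real) set + bool" assume v: "v \<in> \<G> <+> UNIV"
  show "(\<lambda>W. if ?E \<inter> W = {} then Inr (?p \<in> W) else Inl (?E \<inter> W)) (suspension_cell d v) = v"
  proof (cases v)
    case (Inl U)
    then have "cell d U"
      using good_cover_cell[OF assms] v by blast
    then have "?E \<inter> suspension_cell d v = U"
      using cell_subset[of d U] by (auto simp: Inl cylinder_def topspace_Euclidean_space fun_upd_idem)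
    then show ?thesis
      using cell_nonempty[OF \<open>cell d U\<close>] by (simp add: Inl)
  next
    case (Inr b)
    have "?E \<inter> suspension_cell d v = {}" "?p \<in> suspension_cell d v \<longleftrightarrow> b"
      by (auto simp: Inr cylinder_def side_def topspace_Euclidean_space)
    then show ?thesis
      by (simp add: Inr)
  qed
qed

lemma complex_isomorphic_nerve_suspension:
  assumes "finite \<G>" "good_cover d \<G>"
  shows "complex_isomorphic (complex_join (nerve \<G>) two_points) (nerve (suspension_cell d ` (\<G> <+> UNIV)))"
proof -
  let ?K = "complex_join (nerve \<G>) two_points"
  note cells = good_cover_cell[OF assms(2)]
  have "\<Union>(nerve \<G>) = \<G>"
    using cell_nonempty[OF cells, of "{}"] by (auto simp: Union_nerve)
  then have vertices: "\<Union>?K = \<G> <+> UNIV"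
    by (simp add: Union_complex_join Union_two_points nerve_def empty_in_two_points)
  have "\<rho> \<in> ?K \<longleftrightarrow> \<Inter>(suspension_cell d ` \<rho>) \<noteq> {}" if \<rho>: "\<rho> \<subseteq> \<G> <+> UNIV" for \<rho>
  proof -
    let ?I = "\<Inter>(side ` (Inr -` \<rho>))"
    have sub: "Inl -` \<rho> \<subseteq> \<G>"
      using \<rho> by auto
    have "?I = {} \<longleftrightarrow> Inr -` \<rho> = UNIV"
      by (rule Inter_side[of "Inr -` \<rho>"]) auto
    then have "\<rho> \<in> ?K \<longleftrightarrow> \<Inter>(Inl -` \<rho>) \<noteq> {} \<and> ?I \<noteq> {}"
      using sub by (simp add: complex_join_def two_points_def nerve_def)
    also have "\<dots> \<longleftrightarrow> cylinder d (topspace (Euclidean_space d) \<inter> \<Inter>(Inl -` \<rho>)) ?I \<noteq> {}"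
      using sub cells Inter_cells_eq_empty_iff[of "Inl -` \<rho>" d] by (auto simp: cylinder_eq_empty_iff)
    also have "\<dots> \<longleftrightarrow> topspace (Euclidean_space (Suc d)) \<inter> \<Inter>(suspension_cell d ` \<rho>) \<noteq> {}"
      by (simp only: Inter_suspension_cells)
    also have "\<dots> \<longleftrightarrow> \<Inter>(suspension_cell d ` \<rho>) \<noteq> {}"
    proof -
      have "cell (Suc d) W" if "W \<in> suspension_cell d ` \<rho>" for W
        using that sub cells by (auto intro!: cell_suspension_cell simp del: suspension_cell.simps)
      then show ?thesis
        by (simp add: Inter_cells_eq_empty_iff)
    qed
    finally show ?thesis .
  qed
  then show ?thesis
    using complex_isomorphic_nerve_image[of ?K "suspension_cell d"] inj_on_suspension_cell[OF assms(2)]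
      abstract_complex_join[OF abstract_complex_nerve[OF assms(1)] abstract_complex_two_points]
    by (simp add: vertices)
qed

lemma topologically_representable_suspension:
  assumes "topologically_representable d K"
  shows "topologically_representable (Suc d) (complex_join K two_points)"
proof -
  obtain \<G> :: "(nat \<Rightarrow> real) set set" where \<G>: "finite \<G>" "good_cover d \<G>" "complex_isomorphic K (nerve \<G>)"
    using assms unfolding topologically_representable_def by blast
  have "complex_isomorphic (complex_join K two_points) (complex_join (nerve \<G>) two_points)"
    using \<G>(3) empty_in_topologically_representable[OF assms]
    by (rule complex_join_isomorphic_left) (simp_all add: nerve_def empty_in_two_points)
  then have "complex_isomorphic (complex_join K two_points) (nerve (suspension_cell d ` (\<G> <+> UNIV)))"
    using complex_isomorphic_nerve_suspension[OF \<G>(1,2)] by (rule complex_isomorphic_trans)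
  moreover have "finite (suspension_cell d ` (\<G> <+> UNIV))"
    using \<G>(1) by simp
  ultimately show ?thesis
    using good_cover_suspension[OF \<G>(2)] unfolding topologically_representable_def by blast
qed

section \<open>Unions of rectangles\<close>

lemma simply_connected_open_Un:
  fixes S T :: "complex set"
  assumes "open S" "open T" "simply_connected S" "simply_connected T"
    and "connected (S \<inter> T)" "S \<inter> T \<noteq> {}"
  shows "simply_connected (S \<union> T)"
proof -
  have "Borsukian (S \<union> T)"
    using assms by (intro Borsukian_open_Un) (auto simp: simply_connected_eq_Borsukian open_Un openin_open_eq)
  moreover have "connected (S \<union> T)"
    using assms by (intro connected_Un) (auto simp: simply_connected_imp_connected)
  ultimately show ?thesis
    using assms by (simp add: simply_connected_eq_Borsukian open_Un)
qed

type_synonym rect = "int \<times> int \<times> int \<times> int"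

fun open_rect :: "rect \<Rightarrow> complex set" where
  "open_rect (l, r, b, t) = box (Complex l b) (Complex r t)"

fun rect_Int :: "rect \<Rightarrow> rect \<Rightarrow> rect" where
  "rect_Int (l, r, b, t) (l', r', b', t') = (max l l', min r r', max b b', min t t')"

fun nonempty_rect :: "rect \<Rightarrow> bool" where
  "nonempty_rect (l, r, b, t) \<longleftrightarrow> l < r \<and> b < t"

definition region :: "rect list \<Rightarrow> complex set" where
  "region rs = (\<Union>r\<in>set rs. open_rect r)"

definition rects_Int :: "rect list \<Rightarrow> rect list \<Rightarrow> rect list" where
  "rects_Int ps qs = filter nonempty_rect [rect_Int p q. p \<leftarrow> ps, q \<leftarrow> qs]"

lemma open_rect_Int: "open_rect (rect_Int p q) = open_rect p \<inter> open_rect q"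
  by (cases p; cases q) (auto simp: in_box_complex_iff)

lemma open_rect_eq_empty_iff: "open_rect r = {} \<longleftrightarrow> \<not> nonempty_rect r"
  by (cases r) (auto simp: box_eq_empty Basis_complex_def)

lemma open_open_rect: "open (open_rect r)"
  by (cases r) (simp add: open_box)

lemma convex_open_rect: "convex (open_rect r)"
  by (cases r) simp

lemma open_region: "open (region rs)"
  by (simp add: region_def open_open_rect open_UN)

lemma region_simps [simp]: "region [] = {}" "region (r # rs) = open_rect r \<union> region rs"
  by (simp_all add: region_def)

lemma region_rects_Int: "region (rects_Int ps qs) = region ps \<inter> region qs"
proof -
  have "region (rects_Int ps qs) = region [rect_Int p q. p \<leftarrow> ps, q \<leftarrow> qs]"
    unfolding region_def rects_Int_def set_filter using open_rect_eq_empty_iff by blast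
  also have "\<dots> = (\<Union>p\<in>set ps. \<Union>q\<in>set qs. open_rect p \<inter> open_rect q)"
    by (simp add: region_def open_rect_Int del: open_rect.simps)
  also have "\<dots> = region ps \<inter> region qs"
    unfolding region_def by blast
  finally show ?thesis .
qed

lemma rects_Int_eq_Nil_iff: "rects_Int ps qs = [] \<longleftrightarrow> region ps \<inter> region qs = {}"
proof -
  have "open_rect r \<noteq> {}" if "r \<in> set (rects_Int ps qs)" for r
    using that by (simp add: rects_Int_def open_rect_eq_empty_iff)
  then have "region (rects_Int ps qs) = {} \<longleftrightarrow> rects_Int ps qs = []"
    by (cases "rects_Int ps qs") auto
  then show ?thesis
    by (simp add: region_rects_Int)
qed

text \<open>The equation for \<^const>\<open>rect_Int\<close> says that q lies in p, so each rectangle meets the union of the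
  later ones in a single rectangle.\<close>

fun well_glued :: "rect list \<Rightarrow> bool" where
  "well_glued [] \<longleftrightarrow> True"
| "well_glued (r # rs) \<longleftrightarrow> well_glued rs \<and>
     (rs = [] \<or> (let qs = rects_Int [r] rs in \<exists>p\<in>set qs. \<forall>q\<in>set qs. rect_Int p q = q))"

lemma simply_connected_region_if_well_glued: "well_glued rs \<Longrightarrow> simply_connected (region rs)"
proof (induction rs)
  case (Cons r rs)
  show ?case
  proof (cases "rs = []")
    case False
    with Cons.prems obtain p where p: "p \<in> set (rects_Int [r] rs)"
      and max: "\<And>q. q \<in> set (rects_Int [r] rs) \<Longrightarrow> rect_Int p q = q"
      by (simp only: well_glued.simps Let_def) blast
    have "open_rect q \<subseteq> open_rect p" if "q \<in> set (rects_Int [r] rs)" for q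
      using open_rect_Int[of p q] max[OF that] by auto
    then have "region (rects_Int [r] rs) = open_rect p"
      using p unfolding region_def by blast
    then have overlap: "open_rect r \<inter> region rs = open_rect p"
      by (simp add: region_rects_Int)
    have "open_rect p \<noteq> {}"
      using p by (simp add: rects_Int_def open_rect_eq_empty_iff)
    then have "simply_connected (open_rect r \<union> region rs)"
      using Cons
      by (intro simply_connected_open_Un)
        (simp_all add: overlap open_open_rect open_region convex_open_rect convex_connected
          convex_imp_simply_connected)
    then show ?thesis by simp
  qed (simp add: convex_open_rect convex_imp_simply_connected)
qed simp

text \<open>The recursion stops at empty intersections, so it visits the faces of the nerve only.\<close>

fun intersections_well_glued :: "rect list \<Rightarrow> rect list list \<Rightarrow> bool" where
  "intersections_well_glued w [] \<longleftrightarrow> well_glued w"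
| "intersections_well_glued w (u # us) \<longleftrightarrow> intersections_well_glued w us \<and>
     (let v = rects_Int w u in v = [] \<or> intersections_well_glued v us)"

lemma simply_connected_Inter_if_intersections_well_glued:
  assumes "intersections_well_glued w us" "\<H> \<subseteq> region ` set us"
  shows "simply_connected (region w \<inter> \<Inter>\<H>)"
  using assms
proof (induction us arbitrary: w \<H>)
  case Nil
  then show ?case
    by (simp add: simply_connected_region_if_well_glued)
next
  case (Cons u us)
  show ?case
  proof (cases "region u \<in> \<H>")
    case True
    let ?\<H>' = "\<H> - {region u}"
    have eq: "region w \<inter> \<Inter>\<H> = region (rects_Int w u) \<inter> \<Inter>?\<H>'"
      using True by (auto simp: region_rects_Int)
    have "?\<H>' \<subseteq> region ` set us"
      using Cons.prems(2) by auto
    then show ?thesis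
      using Cons.prems(1) Cons.IH[of "rects_Int w u" ?\<H>'] unfolding eq
      by (cases "rects_Int w u = []") (simp_all add: Let_def)
  next
    case False
    with Cons show ?thesis
      by (auto simp: subset_insert)
  qed
qed

section \<open>Planar good covers\<close>

definition plane_point :: "complex \<Rightarrow> nat \<Rightarrow> real" where
  "plane_point z = (\<lambda>_. 0)(0 := Re z, 1 := Im z)"

lemma homeomorphism_plane_point:
  "homeomorphism UNIV (topspace (Euclidean_space 2)) plane_point (\<lambda>x. Complex (x 0) (x 1))"
proof (rule homeomorphismI)
  show "continuous_on UNIV plane_point"
    unfolding plane_point_def by (intro continuous_intros)
  show "continuous_on (topspace (Euclidean_space 2)) (\<lambda>x. Complex (x 0) (x 1))"
    unfolding Complex_eq by (intro continuous_intros)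
  show "plane_point ` UNIV \<subseteq> topspace (Euclidean_space 2)"
    by (auto simp: plane_point_def topspace_Euclidean_space)
  show "plane_point (Complex (x 0) (x 1)) = x" if "x \<in> topspace (Euclidean_space 2)" for x
  proof
    have "i = 0 \<or> i = 1 \<or> 2 \<le> i" for i :: nat
      by linarith
    then show "plane_point (Complex (x 0) (x 1)) i = x i" for i
      using that by (auto simp: plane_point_def topspace_Euclidean_space)
  qed
qed (auto simp: plane_point_def)

lemma range_plane_point: "range plane_point = topspace (Euclidean_space 2)"
  by (rule homeomorphism_image1[OF homeomorphism_plane_point])

lemma inj_plane_point: "inj plane_point"
  using homeomorphism_apply1[OF homeomorphism_plane_point] by (metis UNIV_I injI)

lemma cell_plane_point_image:
  assumes "open U" "simply_connected U" "U \<noteq> {}"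
  shows "cell 2 (plane_point ` U)"
  unfolding cell_iff
proof
  show "openin (Euclidean_space 2) (plane_point ` U)"
    using homeomorphism_imp_open_map[OF homeomorphism_plane_point, of U] assms(1) by simp
  have "homeomorphism U (plane_point ` U) plane_point (\<lambda>x. Complex (x 0) (x 1))"
    by (rule homeomorphism_of_subsets[OF homeomorphism_plane_point])
      (auto simp flip: range_plane_point)
  then have "plane_point ` U homeomorphic U"
    using homeomorphic_def homeomorphic_sym by blast
  also have "U homeomorphic ball (0::complex) 1"
    using simply_connected_eq_homeomorphic_to_disc[OF assms(1)] assms(2,3) by blast
  also have "\<dots> homeomorphic (UNIV :: complex set)"
    by (simp add: homeomorphic_ball_UNIV)
  also have "\<dots> homeomorphic topspace (Euclidean_space 2)"
    using homeomorphism_plane_point homeomorphic_def by blast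
  finally show "plane_point ` U homeomorphic topspace (Euclidean_space 2)" .
qed

lemma good_cover_plane_point_image:
  fixes \<F> :: "complex set set"
  assumes "{} \<notin> \<F>"
    and Inter: "\<And>\<H>. \<lbrakk>\<H> \<subseteq> \<F>; \<H> \<noteq> {}\<rbrakk> \<Longrightarrow> open (\<Inter>\<H>) \<and> simply_connected (\<Inter>\<H>)"
  shows "good_cover 2 ((`) plane_point ` \<F>)"
  unfolding good_cover_def
proof (intro conjI ballI allI impI)
  show "cell 2 W" if "W \<in> (`) plane_point ` \<F>" for W
    using that \<open>{} \<notin> \<F>\<close> Inter[of "{U}" for U] by (force intro: cell_plane_point_image)
  fix \<G> assume "\<G> \<subseteq> (`) plane_point ` \<F>"
  then obtain \<H> where "\<H> \<subseteq> \<F>" and \<G>: "\<G> = (`) plane_point ` \<H>"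
    by (rule subset_imageE)
  show "topspace (Euclidean_space 2) \<inter> \<Inter>\<G> = {} \<or> cell 2 (topspace (Euclidean_space 2) \<inter> \<Inter>\<G>)"
  proof (cases "\<H> = {}")
    case True
    then show ?thesis
      by (simp add: \<G> cell_topspace)
  next
    case False
    then have "plane_point ` \<Inter>\<H> = \<Inter>\<G>"
      using image_INT[OF inj_plane_point, of \<H> "\<lambda>U. U"] by (auto simp: \<G>)
    moreover have "plane_point ` \<Inter>\<H> \<subseteq> topspace (Euclidean_space 2)"
      by (auto simp flip: range_plane_point)
    ultimately have "topspace (Euclidean_space 2) \<inter> \<Inter>\<G> = plane_point ` \<Inter>\<H>"
      by blast
    then show ?thesis
      using Inter[OF \<open>\<H> \<subseteq> \<F>\<close> False] cell_plane_point_image[of "\<Inter>\<H>"] by auto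
  qed
qed

lemma topologically_representable_planar_nerve:
  fixes \<F> :: "complex set set"
  assumes "finite \<F>" "{} \<notin> \<F>"
    and "\<And>\<H>. \<lbrakk>\<H> \<subseteq> \<F>; \<H> \<noteq> {}\<rbrakk> \<Longrightarrow> open (\<Inter>\<H>) \<and> simply_connected (\<Inter>\<H>)"
  shows "topologically_representable 2 (nerve \<F>)"
  using good_cover_plane_point_image[OF assms(2,3)]
    complex_isomorphic_nerve_inj_image[OF inj_plane_point assms(1,2)] assms(1)
  unfolding topologically_representable_def by blast

section \<open>The planar cover\<close>

text \<open>
  The tiles are overlapping bricks that fill the rectangle from (0, 0) to (15, 5). The arcs cover its
  boundary: the top side carries all six inward turns, so the third arc also runs around the other
  three sides. A computer search reduced an initial drawing of this kind to the present coordinates.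
\<close>

definition tiles :: "rect list" where
  "tiles = [(2, 5, 3, 5), (5, 8, 3, 5), (8, 11, 3, 5), (3, 7, 2, 4), (6, 8, 2, 4), (9, 12, 1, 4),
    (10, 14, 1, 3), (7, 9, 2, 5), (8, 10, 2, 4), (11, 13, 2, 5), (0, 2, 0, 5), (13, 15, 1, 5),
    (1, 4, 2, 4), (4, 10, 1, 3), (0, 6, 0, 3), (2, 15, 0, 2)]"

definition arcs :: "rect list list" where
  "arcs = [
    [(1, 3, 3, 5), (0, 10, 4, 5), (8, 10, 2, 5)],
    [(6, 8, 2, 5), (6, 14, 4, 5), (12, 14, 2, 5)],
    [(10, 12, 3, 5), (10, 15, 4, 5), (14, 15, 0, 5), (0, 15, 0, 1), (0, 1, 0, 5), (0, 6, 4, 5),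
     (4, 6, 3, 5)]]"

definition members :: "rect list list" where
  "members = arcs @ map (\<lambda>t. [t]) tiles"

definition frame :: rect where
  "frame = (0, 15, 0, 5)"

lemma members_within_frame: "\<forall>u\<in>set members. \<forall>r\<in>set u. rect_Int frame r = r"
  by code_simp

lemma members_nonempty: "\<forall>u\<in>set members. rects_Int u u \<noteq> []"
  by code_simp

lemma members_intersections_well_glued: "intersections_well_glued [frame] members"
  by code_simp

lemma members_edges_extend:
  "\<forall>u\<in>set members. \<forall>v\<in>set members. let w = rects_Int u v in w \<noteq> [] \<longrightarrow>
     (\<exists>x\<in>set members. rects_Int w x \<noteq> [] \<and>
        (\<exists>y\<in>set members. rects_Int w y \<noteq> [] \<and> rects_Int x y = []))"
  by code_simp

definition planar_cover :: "complex set set" where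
  "planar_cover = region ` set members"

lemma empty_notin_planar_cover: "{} \<notin> planar_cover"
proof
  assume "{} \<in> planar_cover"
  then obtain u where "u \<in> set members" "region u = {}"
    unfolding planar_cover_def by (metis imageE)
  then show False
    using members_nonempty rects_Int_eq_Nil_iff[of u u] by simp
qed

lemma topologically_representable_planar_cover: "topologically_representable 2 (nerve planar_cover)"
proof (rule topologically_representable_planar_nerve)
  show fin: "finite planar_cover"
    by (simp add: planar_cover_def)
  show "{} \<notin> planar_cover"
    by (rule empty_notin_planar_cover)
  fix \<H> assume \<H>: "\<H> \<subseteq> planar_cover" "\<H> \<noteq> {}"
  have "open_rect r \<subseteq> open_rect frame" if "u \<in> set members" "r \<in> set u" for u r
    using open_rect_Int[of frame r] members_within_frame that by auto
  then have "U \<subseteq> region [frame]" if "U \<in> planar_cover" for U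
    using that by (fastforce simp: planar_cover_def region_def simp del: open_rect.simps)
  then have "region [frame] \<inter> \<Inter>\<H> = \<Inter>\<H>"
    using \<H> by blast
  moreover have "simply_connected (region [frame] \<inter> \<Inter>\<H>)"
    using members_intersections_well_glued \<H>(1) unfolding planar_cover_def
    by (rule simply_connected_Inter_if_intersections_well_glued)
  ultimately have "simply_connected (\<Inter>\<H>)"
    by (simp only:)
  moreover have "open (\<Inter>\<H>)"
    using \<H>(1) finite_subset[OF \<H>(1) fin] by (intro open_Inter) (auto simp: planar_cover_def open_region)
  ultimately show "open (\<Inter>\<H>) \<and> simply_connected (\<Inter>\<H>)"
    by blast
qed

lemma abstract_complex_planar_cover: "abstract_complex (nerve planar_cover)"
  by (simp add: abstract_complex_nerve planar_cover_def)

lemma incomplete_links_planar_cover: "incomplete_links 2 (nerve planar_cover)"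
proof (rule incomplete_links_2I[OF abstract_complex_planar_cover])
  have "hd members \<in> set members"
    by (simp add: members_def arcs_def)
  then show "region (hd members) \<in> \<Union>(nerve planar_cover)"
    using empty_notin_planar_cover by (auto simp: Union_nerve planar_cover_def)
  fix U V assume "{U, V} \<in> nerve planar_cover"
  then obtain u v where u: "u \<in> set members" "U = region u" and v: "v \<in> set members" "V = region v"
    and "U \<inter> V \<noteq> {}"
    by (auto simp: nerve_def planar_cover_def)
  define w where "w = rects_Int u v"
  have "w \<noteq> []"
    using \<open>U \<inter> V \<noteq> {}\<close> by (simp add: w_def u v rects_Int_eq_Nil_iff)
  then obtain x y where x: "x \<in> set members" "rects_Int w x \<noteq> []"
    and y: "y \<in> set members" "rects_Int w y \<noteq> []" and "rects_Int x y = []"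
    using members_edges_extend u(1) v(1) unfolding w_def Let_def by blast
  have "region w = U \<inter> V"
    by (simp add: w_def u v region_rects_Int)
  then have "{region x, U, V} \<in> nerve planar_cover" "{region y, U, V} \<in> nerve planar_cover"
    using u v x y by (auto simp: nerve_def planar_cover_def rects_Int_eq_Nil_iff)
  moreover have "{region x, region y} \<notin> nerve planar_cover"
    using \<open>rects_Int x y = []\<close> by (simp add: nerve_def rects_Int_eq_Nil_iff)
  ultimately show "\<exists>X Y. {X, U, V} \<in> nerve planar_cover \<and> {Y, U, V} \<in> nerve planar_cover \<and>
      {X, Y} \<notin> nerve planar_cover"
    by blast
qed

section \<open>Suspending the planar complex\<close>

lemma ex_nat_complex:
  assumes "abstract_complex K" "topologically_representable d K" "incomplete_links n K"
  shows "\<exists>L :: nat set set. abstract_complex L \<and> topologically_representable d L \<and> incomplete_links n L"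
proof -
  obtain L :: "nat set set" where "abstract_complex L" "complex_isomorphic K L"
    using isomorphic_nat_complex[OF assms(1)] .
  then show ?thesis
    using assms(2,3) topologically_representable_isomorphic incomplete_links_isomorphic by blast
qed

lemma exists_representable_complex_with_incomplete_links:
  assumes "2 \<le> d"
  shows "\<exists>K :: nat set set. abstract_complex K \<and> topologically_representable d K \<and> incomplete_links d K"
  using assms
proof (induction d rule: dec_induct)
  case base
  show ?case
    using abstract_complex_planar_cover topologically_representable_planar_cover
      incomplete_links_planar_cover by (rule ex_nat_complex)
next
  case (step d)
  then obtain K :: "nat set set" where K: "abstract_complex K" "topologically_representable d K"
      "incomplete_links d K"
    by blast
  have "incomplete_links (Suc d) (complex_join K two_points)"
    using incomplete_links_join[OF K(1,3) abstract_complex_two_points incomplete_links_two_points] by simp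
  with abstract_complex_join[OF K(1) abstract_complex_two_points] topologically_representable_suspension[OF K(2)]
  show ?case
    by (rule ex_nat_complex)
qed

theorem theorem1p2:
  fixes d :: nat
  assumes "d \<ge> 2"
  shows "\<exists>K :: nat set set.
    abstract_complex K \<and> topologically_representable d K \<and> \<not> collapsible d K"
proof -
  obtain K :: "nat set set" where K: "abstract_complex K" "topologically_representable d K"
      "incomplete_links d K"
    using exists_representable_complex_with_incomplete_links[OF assms] by blast
  have "K \<noteq> {}"
    using empty_in_topologically_representable[OF K(2)] by blast
  then show ?thesis
    using K not_collapsible_if_incomplete_links by blast
qed

end
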